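(* Let $f:\mathbb{R}^p\times\mathbb{R}^d\to\mathbb{R}$ be any feed-forward network family as defined in the context, let $\mathcal{A}$ be any deterministic first-order algorithm, let $\mathcal{D}$ be any distribution on $\mathbb{R}^d\times\mathbb{R}$ and $\ell:\mathbb{R}\times\mathbb{R}\to\mathbb{R}$ any loss function such that $\mathcal{L}(\theta;f)=\mathbb{E}_{(x,y)\sim\mathcal{D}}[\ell(y;f(\theta;x))]$ is finite for every $\theta\in\mathbb{R}^p$, and let $\rho$ be a rotationally invariant sampling distribution on $\mathbb{R}^p$ (i.e. $\rho(\theta)=\rho(V\theta)$ for every $\theta\in\mathbb{R}^p$, $V\in O(p)$). For any $U\in O(d)$, let $V_U\in O(p)$ be the eigenvector matrix of $\mathrm{EGOP}_\rho(\mathcal{L}^{(U)}(\cdot;f))$, let $f_U(\theta;x):=f(V_U\theta;x)$, and let $\theta_t^{(U)}$, $t=0,1,\dots,T$, denote the iterates obtained by running $\mathcal{A}$ for $T$ timesteps on the EGOP-reparameterized objective $\theta\mapsto\mathcal{L}^{(U)}(\theta;f_U)$ from initialization $\theta_0$ (the same $\theta_0$ for all $U$). Then for every $U\in O(d)$, every $x\in\mathbb{R}^d$ and every $t\in\{1,\dots,T\}$, $$f_U\left(\theta^{(U)}_t;x\right)=f_{\mathbb{I}_d}\left(\theta^{(\mathbb{I}_d)}_t;U^{\top}x\right).$$ Moreover, $\theta^{(U)}_t=\theta^{(\mathbb{I}_d)}_t$ for all $t\in\{1,\dots,T\}$.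
   Context: Networks. Fix input dimension $d$, a number $L\ge1$, widths $m_1,\dots,m_{L+1}$ with $m_{L+1}=1$, and activation functions $\sigma_2,\dots,\sigma_{L+1}$ applied entrywise. Parameters: $W_1\in\mathbb{R}^{m_1\times d}$, $W_j\in\mathbb{R}^{m_j\times m_{j-1}}$ for $2\le j\le L+1$, $b_j\in\mathbb{R}^{m_j}$, collected in $\theta=[\mathrm{vec}(W_1),\dots,\mathrm{vec}(W_{L+1}),b_1,\dots,b_{L+1}]\in\mathbb{R}^p$ ($\mathrm{vec}$ is column-major). Then $h_1(\theta;x)=x$, $h_j(\theta;x)=\sigma_j(W_{j-1}h_{j-1}(\theta;x)+b_{j-1})$ for $2\le j\le L+1$, and $f(\theta;x)=W_{L+1}h_{L+1}(\theta;x)+b_{L+1}$. Rotated data. For $U\in O(d)$, $\mathcal{D}^{(U)}$ is the law of $(Ux,y)$ for $(x,y)\sim\mathcal{D}$, i.e. $\mathcal{D}^{(U)}((x,y))=\mathcal{D}((U^{\top}x,y))$. For a forward map $g$, $\mathcal{L}^{(U)}(\theta;g)=\mathbb{E}_{(x,y)\sim\mathcal{D}^{(U)}}[\ell(y;g(\theta;x))]$. EGOP. For a differentiable $\mathcal{L}:\mathbb{R}^p\to\mathbb{R}$, $\mathrm{EGOP}_\rho(\mathcal{L})=\mathbb{E}_{\theta\sim\rho}[\nabla\mathcal{L}(\theta)\nabla\mathcal{L}(\theta)^{\top}]$ (losses are assumed such that this is well defined). Convention on eigenbases: $V_U\in O(p)$ has columns an orthonormal eigenbasis of $\mathrm{EGOP}_\rho(\mathcal{L}^{(U)}(\cdot;f))$,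 and the choices are made consistently: letting $Q^{(U)}\in O(p)$ be block diagonal with blocks $U^{\top}\otimes\mathbb{I}_{m_1}$ (acting on $\mathrm{vec}(W_1)$) and the identity, if $\mathrm{EGOP}_\rho(\mathcal{L}^{(U)}(\cdot;f))=(Q^{(U)})^{\top}\mathrm{EGOP}_\rho(\mathcal{L}^{(\mathbb{I}_d)}(\cdot;f))\,Q^{(U)}$ then the eigenvector matrix selected is $V_U=(Q^{(U)})^{\top}V_{\mathbb{I}_d}$. Algorithms. A deterministic first-order algorithm, given an objective $\mathcal{L}$, generates iterates $\theta_{t+1}=\mathtt{update}(\{\theta_\tau\}_{\tau\le t},\{\nabla_\theta\mathcal{L}(\theta_\tau)\}_{\tau\le t})$ with $\mathtt{update}$ a fixed deterministic function. *)

theory Defs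
  imports "HOL-Probability.Probability"
begin

section \<open>Numbered coordinates\<close>

text \<open>
  The input space is \<^typ>\<open>real ^ 'd\<close> and the parameter space is \<^typ>\<open>real ^ 'p\<close>. The index types
  are of class \<^class>\<open>enum\<close>, so their elements have a canonical listing; this numbers the coordinates
  \<open>0, 1, 2, ...\<close>, which is what the flattening of the weight matrices refers to.
  All rows, columns and coordinates below are numbered from \<open>0\<close>; the layers are numbered
  from \<open>1\<close>.
\<close>

definition coord :: "'a ^ 'n::enum \<Rightarrow> nat \<Rightarrow> 'a" where
  "coord v k = v $ (enum_class.enum ! k)"

definition pos :: "'n::enum \<Rightarrow> nat" where
  "pos i = (THE k. k < CARD('n) \<and> enum_class.enum ! k = i)"


section \<open>Feed-forward networks\<close>

text \<open>
  \<open>m j\<close> is the width \<open>m\<^sub>j\<close>, with \<open>m 0\<close> the input dimension, so that \<open>W\<^sub>j\<close> is an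
  \<open>m j \<times> m (j - 1)\<close> matrix for every \<open>j \<in> {1..L+1}\<close>.
  The parameter vector is \<open>[vec W\<^sub>1, ..., vec W\<^sub>L\<^sub>+\<^sub>1, b\<^sub>1, ..., b\<^sub>L\<^sub>+\<^sub>1]\<close> with column-major \<open>vec\<close>.
\<close>

definition num_params :: "nat \<Rightarrow> (nat \<Rightarrow> nat) \<Rightarrow> nat" where
  "num_params L m = (\<Sum>j=1..L+1. m j * m (j - 1)) + (\<Sum>j=1..L+1. m j)"

definition weight_offset :: "(nat \<Rightarrow> nat) \<Rightarrow> nat \<Rightarrow> nat" where
  "weight_offset m j = (\<Sum>i=1..<j. m i * m (i - 1))"

definition bias_offset :: "nat \<Rightarrow> (nat \<Rightarrow> nat) \<Rightarrow> nat \<Rightarrow> nat" where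
  "bias_offset L m j = (\<Sum>i=1..L+1. m i * m (i - 1)) + (\<Sum>i=1..<j. m i)"

definition weight :: "(nat \<Rightarrow> nat) \<Rightarrow> real ^ 'p::enum \<Rightarrow> nat \<Rightarrow> nat \<Rightarrow> nat \<Rightarrow> real" where
  "weight m \<theta> j r c = coord \<theta> (weight_offset m j + c * m j + r)"

definition bias :: "nat \<Rightarrow> (nat \<Rightarrow> nat) \<Rightarrow> real ^ 'p::enum \<Rightarrow> nat \<Rightarrow> nat \<Rightarrow> real" where
  "bias L m \<theta> j r = coord \<theta> (bias_offset L m j + r)"

text \<open>
  \<open>hidden L m \<sigma> \<theta> x j\<close> is the vector \<open>h\<^sub>j(\<theta>; x)\<close> of dimension \<open>m (j - 1)\<close>, as a function of the
  row number; it is only meaningful for \<open>1 \<le> j \<le> L + 1\<close> and rows below \<open>m (j - 1)\<close>. In the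
  second equation \<open>h\<^sub>j\<^sub>+\<^sub>2\<close> is computed from \<open>W\<^sub>j\<^sub>+\<^sub>1\<close>, \<open>h\<^sub>j\<^sub>+\<^sub>1\<close> and \<open>b\<^sub>j\<^sub>+\<^sub>1\<close>.
\<close>

fun hidden :: "nat \<Rightarrow> (nat \<Rightarrow> nat) \<Rightarrow> (nat \<Rightarrow> real \<Rightarrow> real) \<Rightarrow>
    real ^ 'p::enum \<Rightarrow> real ^ 'd::enum \<Rightarrow> nat \<Rightarrow> nat \<Rightarrow> real" where
  "hidden L m \<sigma> \<theta> x (Suc 0) = coord x"
| "hidden L m \<sigma> \<theta> x (Suc (Suc j)) =
     (\<lambda>r. \<sigma> (Suc (Suc j))
        ((\<Sum>c<m j. weight m \<theta> (Suc j) r c * hidden L m \<sigma> \<theta> x (Suc j) c) + bias L m \<theta> (Suc j) r))"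

text \<open>Since \<open>m (L + 1) = 1\<close>, the output is the single row of the last affine layer.\<close>

definition network :: "nat \<Rightarrow> (nat \<Rightarrow> nat) \<Rightarrow> (nat \<Rightarrow> real \<Rightarrow> real) \<Rightarrow>
    real ^ 'p::enum \<Rightarrow> real ^ 'd::enum \<Rightarrow> real" where
  "network L m \<sigma> \<theta> x =
     (\<Sum>c<m L. weight m \<theta> (L + 1) 0 c * hidden L m \<sigma> \<theta> x (L + 1) c) + bias L m \<theta> (L + 1) 0"


section \<open>Rotated data and losses\<close>

definition rotated_data ::
    "real ^ 'd ^ 'd \<Rightarrow> ((real ^ 'd) \<times> real) measure \<Rightarrow> ((real ^ 'd) \<times> real) measure" where
  "rotated_data U D = distr D borel (\<lambda>(x, y). (U *v x, y))"

definition loss :: "((real ^ 'd) \<times> real) measure \<Rightarrow> (real \<Rightarrow> real \<Rightarrow> real) \<Rightarrow>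
    (real ^ 'p \<Rightarrow> real ^ 'd \<Rightarrow> real) \<Rightarrow> real ^ 'p \<Rightarrow> real" where
  "loss D l g \<theta> = (LINT (x, y)|D. l y (g \<theta> x))"

definition rotated_loss :: "((real ^ 'd) \<times> real) measure \<Rightarrow> (real \<Rightarrow> real \<Rightarrow> real) \<Rightarrow>
    real ^ 'd ^ 'd \<Rightarrow> (real ^ 'p \<Rightarrow> real ^ 'd \<Rightarrow> real) \<Rightarrow> real ^ 'p \<Rightarrow> real" where
  "rotated_loss D l U g = loss (rotated_data U D) l g"

definition reparam :: "real ^ 'p ^ 'p \<Rightarrow> (real ^ 'p \<Rightarrow> real ^ 'd \<Rightarrow> real) \<Rightarrow>
    real ^ 'p \<Rightarrow> real ^ 'd \<Rightarrow> real" where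
  "reparam V g = (\<lambda>\<theta> x. g (V *v \<theta>) x)"

text \<open>Invariance of the law itself, which also covers laws without a density.\<close>

definition rotationally_invariant :: "(real ^ 'p) measure \<Rightarrow> bool" where
  "rotationally_invariant \<rho> \<longleftrightarrow>
     (\<forall>V :: real ^ 'p ^ 'p. orthogonal_matrix V \<longrightarrow> distr \<rho> borel (\<lambda>\<theta>. V *v \<theta>) = \<rho>)"


section \<open>The expected gradient outer product\<close>

definition grad :: "(real ^ 'p \<Rightarrow> real) \<Rightarrow> real ^ 'p \<Rightarrow> real ^ 'p" where
  "grad F \<theta> = (THE g. GDERIV F \<theta> :> g)"

definition grad_outer :: "(real ^ 'p \<Rightarrow> real) \<Rightarrow> real ^ 'p \<Rightarrow> real ^ 'p ^ 'p" where
  "grad_outer F \<theta> =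
     (columnvector (grad F \<theta>) :: real ^ 1 ^ 'p) ** (rowvector (grad F \<theta>) :: real ^ 'p ^ 1)"

definition EGOP :: "(real ^ 'p) measure \<Rightarrow> (real ^ 'p \<Rightarrow> real) \<Rightarrow> real ^ 'p ^ 'p" where
  "EGOP \<rho> F = (LINT \<theta>|\<rho>. grad_outer F \<theta>)"

definition EGOP_well_defined :: "(real ^ 'p) measure \<Rightarrow> (real ^ 'p \<Rightarrow> real) \<Rightarrow> bool" where
  "EGOP_well_defined \<rho> F \<longleftrightarrow>
     (\<forall>\<theta>. F differentiable (at \<theta>)) \<and> integrable \<rho> (grad_outer F)"

definition orthonormal_eigenbasis :: "real ^ 'p ^ 'p \<Rightarrow> real ^ 'p ^ 'p \<Rightarrow> bool" where
  "orthonormal_eigenbasis A V \<longleftrightarrow>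
     orthogonal_matrix V \<and> (\<forall>i. \<exists>c. A *v column i V = c *\<^sub>R column i V)"

text \<open>
  Matrices in the next definition are given by their entries at numbered rows and columns; \<open>B\<close> has
  \<open>r\<close> rows and \<open>s\<close> columns.
\<close>

definition kronecker :: "nat \<Rightarrow> nat \<Rightarrow> (nat \<Rightarrow> nat \<Rightarrow> real) \<Rightarrow> (nat \<Rightarrow> nat \<Rightarrow> real) \<Rightarrow>
    nat \<Rightarrow> nat \<Rightarrow> real" where
  "kronecker r s A B i j = A (i div r) (j div s) * B (i mod r) (j mod s)"

text \<open>
  Block diagonal with blocks \<open>U\<^sup>T \<otimes> I\<close> (the identity having size \<open>m\<^sub>1\<close>), acting on the first
  \<open>m\<^sub>1 d\<close> coordinates \<open>vec W\<^sub>1\<close>, and the identity.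
\<close>

definition input_rotation ::
    "(nat \<Rightarrow> nat) \<Rightarrow> real ^ 'd::enum ^ 'd::enum \<Rightarrow> real ^ 'p::enum ^ 'p::enum" where
  "input_rotation m U = (\<chi> i j.
     if pos i < m 1 * CARD('d) \<and> pos j < m 1 * CARD('d)
     then kronecker (m 1) (m 1) (\<lambda>a b. coord (coord (transpose U) a) b)
            (\<lambda>a b. if a = b then 1 else 0) (pos i) (pos j)
     else if i = j then 1 else 0)"

text \<open>
  \<open>V U\<close> is the eigenvector matrix selected for the EGOP of \<open>F U\<close>. Eigenbases are not unique; the
  second conjunct is the convention that the selection is consistent across rotations.
\<close>

definition eigenbasis_selection :: "(real ^ 'p::enum) measure \<Rightarrow> (nat \<Rightarrow> nat) \<Rightarrow>
    (real ^ 'd::enum ^ 'd::enum \<Rightarrow> real ^ 'p::enum \<Rightarrow> real) \<Rightarrow>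
    (real ^ 'd::enum ^ 'd::enum \<Rightarrow> real ^ 'p::enum ^ 'p::enum) \<Rightarrow> bool" where
  "eigenbasis_selection \<rho> m F V \<longleftrightarrow>
     (\<forall>U. orthogonal_matrix U \<longrightarrow> orthonormal_eigenbasis (EGOP \<rho> (F U)) (V U)) \<and>
     (\<forall>U. orthogonal_matrix U \<longrightarrow>
        EGOP \<rho> (F U) =
          transpose (input_rotation m U) ** EGOP \<rho> (F (mat 1)) ** input_rotation m U \<longrightarrow>
        V U = transpose (input_rotation m U) ** V (mat 1))"


section \<open>Deterministic first-order algorithms\<close>

text \<open>
  An algorithm is its update function, which maps the lists of all past iterates and of the
  gradients at them (oldest first) to the next iterate.
\<close>

definition iterates_of :: "((real ^ 'p) list \<Rightarrow> (real ^ 'p) list \<Rightarrow> real ^ 'p) \<Rightarrow>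
    (real ^ 'p \<Rightarrow> real) \<Rightarrow> real ^ 'p \<Rightarrow> nat \<Rightarrow> (nat \<Rightarrow> real ^ 'p) \<Rightarrow> bool" where
  "iterates_of update F \<theta>0 T \<theta> \<longleftrightarrow>
     \<theta> 0 = \<theta>0 \<and>
     (\<forall>t<T. \<theta> (Suc t) = update (map \<theta> [0..<Suc t]) (map (\<lambda>\<tau>. grad F (\<theta> \<tau>)) [0..<Suc t]))"

end

theory Submission
  imports Defs
begin

text \<open>
  Feeding the network \<open>U x\<close> instead of \<open>x\<close> has the same effect as replacing \<open>W\<^sub>1\<close> by \<open>W\<^sub>1 U\<close>,
  that is, \<open>\<theta>\<close> by \<open>Q \<theta>\<close> with \<open>Q\<close> the orthogonal matrix \<^term>\<open>input_rotation m U\<close>. Hence the loss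
  on rotated data is the original loss precomposed with \<open>Q\<close>, and the rotational invariance of \<open>\<rho>\<close>
  turns the chain rule for gradients into the conjugation by \<open>Q\<close> of the EGOP that the selection
  convention asks for. So \<open>V U = Q\<^sup>T V I\<close>, the reparameterized objectives agree, and so do
  the iterates.
\<close>

section \<open>Numbered coordinates of vectors and matrices\<close>

lemma enum_nth_eq_iff:
  assumes "a < CARD('n::enum)" "b < CARD('n)"
  shows "(enum_class.enum ! a :: 'n) = enum_class.enum ! b \<longleftrightarrow> a = b"
  using assms by (simp add: nth_eq_iff_index_eq[OF enum_distinct] card_UNIV_length_enum)

lemma pos_enum_nth: "k < CARD('n::enum) \<Longrightarrow> pos (enum_class.enum ! k :: 'n) = k"
  unfolding pos_def by (rule the_equality) (auto simp: enum_nth_eq_iff)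

lemma bij_betw_enum_nth:
  "bij_betw (\<lambda>k. enum_class.enum ! k :: 'n::enum) {..<CARD('n)} UNIV"
  by (rule bij_betw_nth[OF enum_distinct]) (simp_all only: card_UNIV_length_enum flip: UNIV_enum)

lemma sum_UNIV_enum:
  "(\<Sum>(i::'n::enum)\<in>UNIV. g i) = (\<Sum>k<CARD('n). g (enum_class.enum ! k))"
  by (rule sum.reindex_bij_betw[OF bij_betw_enum_nth, symmetric])

lemma enum_nthE:
  obtains k where "k < CARD('n::enum)" "i = (enum_class.enum ! k :: 'n)"
  using bij_betw_enum_nth[where 'n = 'n] unfolding bij_betw_def by blast

lemma coord_eqI:
  fixes u v :: "'a ^ 'n::enum"
  assumes "\<And>k. k < CARD('n) \<Longrightarrow> coord u k = coord v k"
  shows "u = v"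
  unfolding vec_eq_iff
proof
  fix i :: 'n
  obtain k where "k < CARD('n)" "i = enum_class.enum ! k" by (rule enum_nthE)
  with assms[of k] show "u $ i = v $ i" by (simp add: coord_def)
qed

lemma coord_matrix_vector_mult:
  fixes A :: "real ^ 'n::enum ^ 'k::enum"
  shows "coord (A *v v) i = (\<Sum>j<CARD('n). coord (coord A i) j * coord v j)"
  by (simp add: coord_def matrix_vector_mult_def sum_UNIV_enum)

lemma coord_transpose: "coord (coord (transpose A) i) j = coord (coord A j) i"
  by (simp add: coord_def transpose_def)

lemma coord_mat_1:
  assumes "i < CARD('n)" "j < CARD('n)"
  shows "coord (coord (mat 1 :: real ^ 'n::enum ^ 'n::enum) i) j = (if i = j then 1 else 0)"
  using assms by (simp add: coord_def mat_def enum_nth_eq_iff)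

section \<open>The input rotation as an orthogonal matrix\<close>

lemma coord_input_rotation:
  fixes U :: "real ^ 'd::enum ^ 'd::enum"
  assumes "i < CARD('p::enum)" "j < CARD('p)"
  shows "coord (coord (input_rotation m U :: real ^ 'p::enum ^ 'p::enum) i) j =
    (if i < m 1 * CARD('d) \<and> j < m 1 * CARD('d)
     then if i mod m 1 = j mod m 1 then coord (coord U (j div m 1)) (i div m 1) else 0
     else if i = j then 1 else 0)"
  using assms
  by (simp add: coord_def input_rotation_def pos_enum_nth enum_nth_eq_iff kronecker_def transpose_def)

text \<open>Every coordinate past \<open>vec W_1\<close> lies in the identity block, so later
  weights and all biases are left alone.\<close>

lemma coord_input_rotation_mult_outside:
  fixes U :: "real ^ 'd::enum ^ 'd::enum" and \<theta> :: "real ^ 'p::enum"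
  assumes "k < CARD('p)" "m 1 * CARD('d) \<le> k"
  shows "coord (input_rotation m U *v \<theta>) k = coord \<theta> k"
proof -
  have "coord (input_rotation m U *v \<theta>) k =
      (\<Sum>j<CARD('p). (if k = j then 1 else 0) * coord \<theta> j)"
    unfolding coord_matrix_vector_mult
    by (rule sum.cong) (use assms in \<open>auto simp: coord_input_rotation\<close>)
  also have "\<dots> = (\<Sum>j<CARD('p). if k = j then coord \<theta> j else 0)"
    by (rule sum.cong) auto
  finally show ?thesis using assms by simp
qed

lemma block_index_less: "c < d \<Longrightarrow> r < n \<Longrightarrow> c * n + r < d * (n::nat)"
proof -
  assume "c < d" "r < n"
  then have "c * n + r < Suc c * n" by simp
  also have "\<dots> \<le> d * n" using \<open>c < d\<close> by (intro mult_le_mono1) simp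
  finally show ?thesis .
qed

text \<open>In column-major order, position \<open>c * m 1 + r\<close> holds the entry of
  \<open>W_1\<close> in row \<open>r\<close> and column \<open>c\<close>. The sum is the same entry
  of the product \<open>W_1 U\<close>, so this is the usual rule that \<open>U^T \<otimes> I\<close>
  acts on \<open>vec W_1\<close> as right multiplication by \<open>U\<close>.\<close>

lemma coord_input_rotation_mult_block:
  fixes U :: "real ^ 'd::enum ^ 'd::enum" and \<theta> :: "real ^ 'p::enum"
  assumes p: "m 1 * CARD('d) \<le> CARD('p)" and c: "c < CARD('d)" and r: "r < m 1"
  shows "coord (input_rotation m U *v \<theta>) (c * m 1 + r) =
    (\<Sum>a<CARD('d). coord (coord U a) c * coord \<theta> (a * m 1 + r))"
proof -
  let ?k = "c * m 1 + r" and ?g = "\<lambda>a. a * m 1 + r"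
  let ?h = "\<lambda>j. coord (coord (input_rotation m U :: real ^ 'p::enum ^ 'p::enum) ?k) j * coord \<theta> j"
  have lt: "?g a < m 1 * CARD('d)" if "a < CARD('d)" for a
    using block_index_less[OF that r] by (simp add: mult.commute)
  have k: "?k < m 1 * CARD('d)" using lt[OF c] .
  have lt_p: "?g a < CARD('p)" if "a < CARD('d)" for a
    using lt[OF that] p by (rule less_le_trans)
  have inj: "inj_on ?g {..<CARD('d)}" using r by (auto simp: inj_on_def)
  \<comment> \<open>The image of \<open>?g\<close> consists of the positions of row \<open>r\<close>
    of \<open>W_1\<close>. The identity factor of the Kronecker product annihilates every other
    position of the first block, and positions outside that block contribute nothing because
    \<open>?k\<close> is inside.\<close>
  have "sum ?h (?g ` {..<CARD('d)}) = sum ?h {..<CARD('p)}"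
  proof (rule sum.mono_neutral_left)
    show "?g ` {..<CARD('d)} \<subseteq> {..<CARD('p)}"
      using lt_p by auto
    show "\<forall>j\<in>{..<CARD('p)} - ?g ` {..<CARD('d)}. ?h j = 0"
    proof
      fix j assume j: "j \<in> {..<CARD('p)} - ?g ` {..<CARD('d)}"
      have "j mod m 1 \<noteq> r" if "j < m 1 * CARD('d)"
      proof
        assume "j mod m 1 = r"
        then have "j = ?g (j div m 1)" using div_mult_mod_eq[of j "m 1"] by simp
        moreover have "j div m 1 < CARD('d)"
          using that by (simp add: less_mult_imp_div_less mult.commute)
        ultimately show False using j by blast
      qed
      then show "?h j = 0" using j k p r by (auto simp: coord_input_rotation)
    qed
  qed simp
  then have "coord (input_rotation m U *v \<theta>) ?k = (\<Sum>a<CARD('d). ?h (?g a))"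
    unfolding coord_matrix_vector_mult sum.reindex[OF inj] by (simp only: o_def)
  also have "\<dots> = (\<Sum>a<CARD('d). coord (coord U a) c * coord \<theta> (?g a))"
    by (rule sum.cong) (use k r in \<open>auto simp: coord_input_rotation lt lt_p c simp del: One_nat_def\<close>)
  finally show ?thesis .
qed

text \<open>Transposition passes to both Kronecker factors, and the identity factor is
  symmetric.\<close>

lemma transpose_input_rotation:
  fixes U :: "real ^ 'd::enum ^ 'd::enum"
  shows "transpose (input_rotation m U) = (input_rotation m (transpose U) :: real ^ 'p::enum ^ 'p::enum)"
  by (intro coord_eqI) (auto simp: coord_transpose coord_input_rotation)

text \<open>On the first block the two factors send \<open>W_1\<close> to \<open>W_1 U^T\<close> and
  then to \<open>W_1 U^T U\<close>, which is \<open>W_1\<close> again.\<close>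

lemma input_rotation_mult_transpose:
  fixes U :: "real ^ 'd::enum ^ 'd::enum" and \<theta> :: "real ^ 'p::enum"
  assumes p: "m 1 * CARD('d) \<le> CARD('p)" and U: "transpose U ** U = mat 1"
  shows "input_rotation m U *v (input_rotation m (transpose U) *v \<theta>) = \<theta>"
proof (rule coord_eqI)
  fix k assume k: "k < CARD('p)"
  show "coord (input_rotation m U *v (input_rotation m (transpose U) *v \<theta>)) k = coord \<theta> k"
  proof (cases "k < m 1 * CARD('d)")
    case False
    then show ?thesis using k by (simp add: coord_input_rotation_mult_outside)
  next
    case True
    define c r where "c = k div m 1" and "r = k mod m 1"
    have c: "c < CARD('d)"
      using True by (simp add: c_def less_mult_imp_div_less mult.commute)
    have r: "r < m 1" using True by (cases "m 1") (auto simp: r_def)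
    have k_eq: "k = c * m 1 + r" by (simp add: c_def r_def)
    have UU: "(\<Sum>a<CARD('d). coord (coord U a) c * coord (coord U a) b) = (if c = b then 1 else 0)"
      if "b < CARD('d)" for b
    proof -
      have "(\<Sum>a<CARD('d). coord (coord U a) c * coord (coord U a) b) =
          coord (coord (transpose U ** U) c) b"
        by (simp add: coord_def matrix_matrix_mult_def transpose_def sum_UNIV_enum)
      then show ?thesis using U c that by (simp add: coord_mat_1)
    qed
    have "coord (input_rotation m U *v (input_rotation m (transpose U) *v \<theta>)) k =
        (\<Sum>a<CARD('d). \<Sum>b<CARD('d).
           coord (coord U a) c * coord (coord U a) b * coord \<theta> (b * m 1 + r))"
      using p c r unfolding k_eq
      by (simp add: coord_input_rotation_mult_block coord_transpose sum_distrib_left mult.assoc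
          del: One_nat_def)
    \<comment> \<open>With the sums exchanged, the inner sum over \<open>a\<close> is an entry of
      \<open>U^T U\<close>, evaluated by \<open>UU\<close>.\<close>
    also have "\<dots> = (\<Sum>b<CARD('d). (if c = b then 1 else 0) * coord \<theta> (b * m 1 + r))"
      by (subst sum.swap) (simp add: UU flip: sum_distrib_right)
    also have "\<dots> = (\<Sum>b<CARD('d). if c = b then coord \<theta> (b * m 1 + r) else 0)"
      by (rule sum.cong) auto
    finally show ?thesis using c by (simp add: k_eq)
  qed
qed

lemma orthogonal_matrix_input_rotation:
  fixes U :: "real ^ 'd::enum ^ 'd::enum"
  assumes "m 1 * CARD('d) \<le> CARD('p::enum)" and "orthogonal_matrix U"
  shows "orthogonal_matrix (input_rotation m U :: real ^ 'p::enum ^ 'p::enum)"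
proof -
  have "input_rotation m U ** transpose (input_rotation m U) = (mat 1 :: real ^ 'p::enum ^ 'p::enum)"
    using input_rotation_mult_transpose[of m U, OF assms(1)] assms(2)
    by (simp add: matrix_eq transpose_input_rotation orthogonal_matrix_def
        flip: matrix_vector_mul_assoc)
  \<comment> \<open>For square matrices a right inverse is also a left inverse.\<close>
  then show ?thesis
    by (metis matrix_left_right_inverse orthogonal_matrix_def)
qed

section \<open>Layout of the parameter vector\<close>

lemma weight_index_bounds:
  assumes "j \<in> {1..L+1}" "c < m (j - 1)" "r < m j"
  shows "weight_offset m j + c * m j + r < num_params L m"
proof -
  have "weight_offset m j + (c * m j + r) < weight_offset m j + m j * m (j - 1)"
    using block_index_less[OF assms(2,3)] by (simp add: mult.commute)
  also have "\<dots> = (\<Sum>i=1..j. m i * m (i - 1))"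
    using assms(1) by (simp add: weight_offset_def atLeastLessThanSuc_atLeastAtMost[symmetric])
  also have "\<dots> \<le> (\<Sum>i=1..L+1. m i * m (i - 1))"
    using assms(1) by (intro sum_mono2) auto
  also have "\<dots> \<le> num_params L m" by (simp add: num_params_def)
  finally show ?thesis by simp
qed

text \<open>From the second layer on, weights are stored behind the block of \<open>W_1\<close>,
  hence out of reach of the rotation.\<close>

lemma weight_offset_ge:
  assumes "2 \<le> j"
  shows "m 1 * m 0 \<le> weight_offset m j"
proof -
  have "(\<Sum>i\<in>{1}. m i * m (i - 1)) \<le> weight_offset m j"
    unfolding weight_offset_def using assms by (intro sum_mono2) auto
  then show ?thesis by simp
qed

lemma first_block_le_weights: "(m :: nat \<Rightarrow> nat) 1 * m 0 \<le> (\<Sum>i=1..L+1. m i * m (i - 1))"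
  \<comment> \<open>The offset of the fictitious layer \<open>L + 2\<close> is the total size of all
    weight blocks.\<close>
  using weight_offset_ge[of "L + 2" m]
  by (simp add: weight_offset_def atLeastLessThanSuc_atLeastAtMost)

lemma first_block_le_num_params: "m 1 * m 0 \<le> num_params L m"
  using first_block_le_weights[of m L] by (simp add: num_params_def)

lemma bias_index_bounds:
  assumes "j \<in> {1..L+1}" "r < m j"
  shows "bias_offset L m j + r < num_params L m" and "m 1 * m 0 \<le> bias_offset L m j + r"
proof -
  have "(\<Sum>i=1..<j. m i) + r < (\<Sum>i=1..<j. m i) + m j" using assms by simp
  also have "\<dots> = (\<Sum>i=1..j. m i)"
    using assms(1) by (simp add: atLeastLessThanSuc_atLeastAtMost[symmetric])
  also have "\<dots> \<le> (\<Sum>i=1..L+1. m i)"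
    using assms(1) by (intro sum_mono2) auto
  finally show "bias_offset L m j + r < num_params L m"
    by (simp add: bias_offset_def num_params_def)
  show "m 1 * m 0 \<le> bias_offset L m j + r"
    using first_block_le_weights[of m L] by (simp add: bias_offset_def)
qed

section \<open>Rotating the input versus rotating the parameters\<close>

context
  fixes L :: nat and m :: "nat \<Rightarrow> nat" and U :: "real ^ 'd::enum ^ 'd::enum" and \<theta> :: "real ^ 'p::enum"
  assumes m0: "m 0 = CARD('d)" and params: "CARD('p) = num_params L m"
begin

lemma bias_input_rotation:
  assumes "j \<in> {1..L+1}" "r < m j"
  shows "bias L m (input_rotation m U *v \<theta>) j r = bias L m \<theta> j r"
  unfolding bias_def using bias_index_bounds[of j L r m, OF assms] m0 params
  by (intro coord_input_rotation_mult_outside) auto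

lemma weight_input_rotation:
  assumes "j \<in> {2..L+1}" "c < m (j - 1)" "r < m j"
  shows "weight m (input_rotation m U *v \<theta>) j r c = weight m \<theta> j r c"
  unfolding weight_def
  using weight_index_bounds[of j L c m r] weight_offset_ge[of j m] assms m0 params
  by (intro coord_input_rotation_mult_outside) auto

text \<open>This is associativity, \<open>(W_1 U) x = W_1 (U x)\<close>, obtained by exchanging two
  finite sums.\<close>

lemma first_layer_input_rotation:
  assumes r: "r < m 1"
  shows "(\<Sum>c<m 0. weight m (input_rotation m U *v \<theta>) 1 r c * coord x c) =
    (\<Sum>c<m 0. weight m \<theta> 1 r c * coord (U *v x) c)"
proof -
  have p: "m 1 * CARD('d) \<le> CARD('p)"
    using first_block_le_num_params[of m L] m0 params by simp
  have "(\<Sum>c<m 0. weight m (input_rotation m U *v \<theta>) 1 r c * coord x c) =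
      (\<Sum>c<CARD('d). \<Sum>a<CARD('d). weight m \<theta> 1 r a * (coord (coord U a) c * coord x c))"
    unfolding m0 weight_def weight_offset_def
    by (rule sum.cong)
      (simp_all add: coord_input_rotation_mult_block[of m, OF p _ r] sum_distrib_left mult_ac
        del: One_nat_def)
  also have "\<dots> = (\<Sum>a<CARD('d). weight m \<theta> 1 r a * coord (U *v x) a)"
    by (subst sum.swap) (simp add: coord_matrix_vector_mult sum_distrib_left)
  finally show ?thesis unfolding m0 .
qed

text \<open>The induction starts at \<open>h_2\<close>, since \<open>h_1\<close> is the raw input,
  which is \<open>x\<close> on one side and \<open>U x\<close> on the other. The first layer absorbs
  this difference, and all later layers use unchanged parameters.\<close>

lemma hidden_input_rotation:
  assumes "j + 2 \<le> L + 1" "r < m (j + 1)"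
  shows "hidden L m \<sigma> (input_rotation m U *v \<theta>) x (j + 2) r = hidden L m \<sigma> \<theta> (U *v x) (j + 2) r"
  using assms
proof (induction j arbitrary: r)
  case 0
  then show ?case
    using first_layer_input_rotation[of r x] bias_input_rotation[of 1 r]
    by (simp add: numeral_2_eq_2)
next
  case (Suc j)
  have "(\<Sum>c<m (j + 1). weight m (input_rotation m U *v \<theta>) (j + 2) r c *
        hidden L m \<sigma> (input_rotation m U *v \<theta>) x (j + 2) c) =
      (\<Sum>c<m (j + 1). weight m \<theta> (j + 2) r c * hidden L m \<sigma> \<theta> (U *v x) (j + 2) c)"
    by (rule sum.cong) (use Suc in \<open>auto simp: weight_input_rotation simp del: hidden.simps\<close>)
  then show ?case
    using Suc.prems bias_input_rotation[of "j + 2" r] by (simp add: numeral_2_eq_2)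
qed

lemma network_input_rotation:
  assumes L: "L \<ge> 1" and out: "m (L + 1) = 1"
  shows "network L m \<sigma> (input_rotation m U *v \<theta>) x = network L m \<sigma> \<theta> (U *v x)"
proof -
  \<comment> \<open>Now \<open>L + 1 = k + 2\<close>, so the last hidden vector is within the scope
    of \<open>hidden_input_rotation\<close>, and the output weights are not those of the first
    layer.\<close>
  obtain k where k: "L = k + 1" using L by (metis add.commute le_Suc_ex)
  have "(\<Sum>c<m L. weight m (input_rotation m U *v \<theta>) (L + 1) 0 c *
        hidden L m \<sigma> (input_rotation m U *v \<theta>) x (L + 1) c) =
      (\<Sum>c<m L. weight m \<theta> (L + 1) 0 c * hidden L m \<sigma> \<theta> (U *v x) (L + 1) c)"
  proof (rule sum.cong)
    fix c assume c: "c \<in> {..<m L}"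
    have "hidden L m \<sigma> (input_rotation m U *v \<theta>) x (L + 1) c = hidden L m \<sigma> \<theta> (U *v x) (L + 1) c"
      using hidden_input_rotation[of k c] c k by (simp del: hidden.simps)
    moreover have "weight m (input_rotation m U *v \<theta>) (L + 1) 0 c = weight m \<theta> (L + 1) 0 c"
      using c L out by (intro weight_input_rotation) auto
    ultimately show "weight m (input_rotation m U *v \<theta>) (L + 1) 0 c *
        hidden L m \<sigma> (input_rotation m U *v \<theta>) x (L + 1) c =
        weight m \<theta> (L + 1) 0 c * hidden L m \<sigma> \<theta> (U *v x) (L + 1) c" by simp
  qed simp
  then show ?thesis
    using out by (simp add: network_def bias_input_rotation)
qed

end

section \<open>Losses, gradients and the EGOP under linear substitution\<close>

text \<open>This is the change of variables for the pushforward of \<open>D\<close>. Measurability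
  of the integrand is extracted from its integrability, so neither \<open>l\<close> nor
  \<open>g\<close> needs to be measurable by assumption.\<close>

lemma rotated_loss_eq:
  fixes g :: "real ^ 'p \<Rightarrow> real ^ 'd \<Rightarrow> real"
  assumes D: "sets D = sets borel" and int: "integrable D (\<lambda>(x, y). l y (g \<theta> x))"
  shows "rotated_loss D l U g \<theta> = (LINT (x, y)|D. l y (g \<theta> (U *v x)))"
proof -
  have "(\<lambda>(x, y). l y (g \<theta> x)) \<in> borel_measurable D" using int by (rule borel_measurable_integrable)
  then have meas: "(\<lambda>(x, y). l y (g \<theta> x)) \<in> borel_measurable borel"
    using measurable_cong_sets[OF D refl] by blast
  have "continuous_on UNIV (\<lambda>z :: (real ^ 'd) \<times> real. (U *v fst z, snd z))"
    by (intro continuous_intros continuous_on_compose2[OF matrix_vector_mult_linear_continuous_on]) auto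
  then have "(\<lambda>(x, y). (U *v x, y)) \<in> borel_measurable D"
    using borel_measurable_continuous_onI measurable_cong_sets[OF D refl]
    unfolding case_prod_beta by blast
  then show ?thesis
    unfolding rotated_loss_def loss_def rotated_data_def
    by (subst integral_distr[OF _ meas]) (simp_all add: case_prod_beta')
qed

lemma grad_eqI:
  assumes "GDERIV F \<theta> :> g"
  shows "grad F \<theta> = g"
  unfolding grad_def
proof (rule the_equality[where P = "\<lambda>g. GDERIV F \<theta> :> g", OF assms])
  fix g' assume "GDERIV F \<theta> :> g'"
  with assms have "(\<lambda>h. h \<bullet> g') = (\<lambda>h. h \<bullet> g)"
    unfolding gderiv_def by (rule has_derivative_unique[rotated])
  then show "g' = g" by (metis vector_eq_ldot inner_commute)
qed

text \<open>Riesz representation: the derivative \<open>F'\<close> is a linear functional, and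
  \<open>adjoint F' 1\<close> is the vector that represents it.\<close>

lemma gderiv_grad:
  fixes F :: "real ^ 'p \<Rightarrow> real"
  assumes "F differentiable (at \<theta>)"
  shows "GDERIV F \<theta> :> grad F \<theta>"
proof -
  obtain F' where F': "(F has_derivative F') (at \<theta>)"
    using assms unfolding differentiable_def by blast
  have "F' h = h \<bullet> adjoint F' 1" for h
    using adjoint_works[OF has_derivative_linear[OF F'], of h 1] by simp
  then have "GDERIV F \<theta> :> adjoint F' 1"
    using F' unfolding gderiv_def by (metis (no_types, lifting) ext)
  then show ?thesis using grad_eqI by metis
qed

lemma grad_compose_matrix:
  fixes F :: "real ^ 'p \<Rightarrow> real" and A :: "real ^ 'n ^ 'p"
  assumes "F differentiable (at (A *v \<theta>))"
  shows "grad (\<lambda>\<theta>. F (A *v \<theta>)) \<theta> = transpose A *v grad F (A *v \<theta>)"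
proof (rule grad_eqI)
  have "(F has_derivative (\<lambda>h. h \<bullet> grad F (A *v \<theta>))) (at (A *v \<theta>))"
    using gderiv_grad[OF assms] by (simp add: gderiv_def)
  then have "((\<lambda>\<theta>. F (A *v \<theta>)) has_derivative (\<lambda>h. (A *v h) \<bullet> grad F (A *v \<theta>))) (at \<theta>)"
    by (rule has_derivative_compose[rotated])
      (simp add: bounded_linear_imp_has_derivative matrix_vector_mul_bounded_linear)
  then show "GDERIV (\<lambda>\<theta>. F (A *v \<theta>)) \<theta> :> transpose A *v grad F (A *v \<theta>)"
    by (simp add: gderiv_def transpose_matrix_vector dot_lmul_matrix inner_commute[of _ "_ v* _"])
      (simp add: inner_commute)
qed

lemma grad_outer_compose_matrix:
  fixes F :: "real ^ 'p \<Rightarrow> real" and A :: "real ^ 'p ^ 'p"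
  assumes "F differentiable (at (A *v \<theta>))"
  shows "grad_outer (\<lambda>\<theta>. F (A *v \<theta>)) \<theta> = transpose A ** grad_outer F (A *v \<theta>) ** A"
proof -
  let ?g = "grad F (A *v \<theta>)"
  have "(columnvector (transpose A *v ?g) :: real ^ 1 ^ 'p) = transpose A ** columnvector ?g"
    by (simp add: vec_eq_iff columnvector_def matrix_matrix_mult_def matrix_vector_mult_def)
  moreover have "(rowvector (transpose A *v ?g) :: real ^ 'p ^ 1) = rowvector ?g ** A"
    by (simp add: vec_eq_iff rowvector_def matrix_matrix_mult_def matrix_vector_mult_def
        transpose_def mult.commute)
  ultimately show ?thesis
    by (simp add: grad_outer_def grad_compose_matrix[of F A, OF assms] matrix_mul_assoc)
qed

text \<open>Boundedness and linearity allow the two outer factors to be pulled out of the Bochner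
  integral that defines the EGOP.\<close>

lemma bounded_linear_matrix_conj:
  fixes A B :: "real ^ 'p ^ 'p"
  shows "bounded_linear (\<lambda>M. A ** M ** B)"
  unfolding linear_conv_bounded_linear[symmetric]
  by (rule linearI)
    (simp_all add: vec_eq_iff matrix_matrix_mult_def distrib_left distrib_right sum.distrib
      sum_distrib_left sum_distrib_right mult.left_commute mult.assoc)

text \<open>The chain rule conjugates each outer product at \<open>Q *v \<theta>\<close>. Since
  \<open>Q *v \<theta>\<close> has the same law \<open>\<rho>\<close> as \<open>\<theta>\<close>,
  averaging removes \<open>Q\<close> from the evaluation point and only the conjugation
  remains.\<close>

lemma EGOP_compose_orthogonal:
  fixes F :: "real ^ 'p \<Rightarrow> real" and Q :: "real ^ 'p ^ 'p"
  assumes Q: "orthogonal_matrix Q" and sets: "sets \<rho> = sets borel"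
    and inv: "rotationally_invariant \<rho>" and wd: "EGOP_well_defined \<rho> F"
  shows "EGOP \<rho> (\<lambda>\<theta>. F (Q *v \<theta>)) = transpose Q ** EGOP \<rho> F ** Q"
proof -
  have diff: "F differentiable (at \<theta>)" for \<theta> using wd by (simp add: EGOP_well_defined_def)
  have int: "integrable \<rho> (grad_outer F)" using wd by (simp add: EGOP_well_defined_def)
  have distr: "distr \<rho> borel (\<lambda>\<theta>. Q *v \<theta>) = \<rho>"
    using inv Q by (simp add: rotationally_invariant_def)
  have Q_meas: "(\<lambda>\<theta>. Q *v \<theta>) \<in> borel_measurable \<rho>"
    using borel_measurable_continuous_onI[OF matrix_vector_mult_linear_continuous_on]
      measurable_cong_sets[OF sets refl] by blast
  have G_meas: "grad_outer F \<in> borel_measurable borel"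
    using borel_measurable_integrable[OF int] measurable_cong_sets[OF sets refl] by blast
  \<comment> \<open>Invariance of \<open>\<rho>\<close> also transfers integrability to the rotated
    evaluation point.\<close>
  have int': "integrable \<rho> (\<lambda>\<theta>. grad_outer F (Q *v \<theta>))"
    using integrable_distr_eq[OF Q_meas G_meas] distr int by simp
  have "EGOP \<rho> (\<lambda>\<theta>. F (Q *v \<theta>)) = (LINT \<theta>|\<rho>. transpose Q ** grad_outer F (Q *v \<theta>) ** Q)"
    unfolding EGOP_def
    by (intro Bochner_Integration.integral_cong refl grad_outer_compose_matrix diff)
  also have "\<dots> = transpose Q ** (LINT \<theta>|\<rho>. grad_outer F (Q *v \<theta>)) ** Q"
    by (rule integral_bounded_linear[OF bounded_linear_matrix_conj int'])
  also have "(LINT \<theta>|\<rho>. grad_outer F (Q *v \<theta>)) = EGOP \<rho> F"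
    using integral_distr[OF Q_meas G_meas] distr by (simp add: EGOP_def)
  finally show ?thesis .
qed

text \<open>The update reads the entire history, so strong induction is used: agreement at all
  earlier times makes both argument lists equal.\<close>

lemma iterates_of_unique:
  assumes "iterates_of update F \<theta>0 T \<theta>" "iterates_of update F \<theta>0 T \<theta>'" "t \<le> T"
  shows "\<theta> t = \<theta>' t"
  using assms(3)
proof (induction t rule: less_induct)
  case (less t)
  show ?case
  proof (cases t)
    case 0
    then show ?thesis using assms by (simp add: iterates_of_def)
  next
    case (Suc s)
    have "map \<theta> [0..<Suc s] = map \<theta>' [0..<Suc s]"
      "map (\<lambda>\<tau>. grad F (\<theta> \<tau>)) [0..<Suc s] = map (\<lambda>\<tau>. grad F (\<theta>' \<tau>)) [0..<Suc s]"
      using less Suc by (auto intro!: map_cong simp del: upt_Suc)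
    then show ?thesis
      using assms(1,2) less.prems Suc unfolding iterates_of_def by (metis Suc_le_lessD)
  qed
qed


theorem theorem5:
  fixes L :: nat and m :: "nat \<Rightarrow> nat" and \<sigma> :: "nat \<Rightarrow> real \<Rightarrow> real"
    and f :: "real ^ 'p::enum \<Rightarrow> real ^ 'd::enum \<Rightarrow> real"
    and D :: "((real ^ 'd::enum) \<times> real) measure" and l :: "real \<Rightarrow> real \<Rightarrow> real"
    and \<rho> :: "(real ^ 'p::enum) measure"
    and V :: "real ^ 'd::enum ^ 'd::enum \<Rightarrow> real ^ 'p::enum ^ 'p::enum"
    and update :: "(real ^ 'p::enum) list \<Rightarrow> (real ^ 'p::enum) list \<Rightarrow> real ^ 'p::enum"
    and \<theta>0 :: "real ^ 'p::enum" and T :: nat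
    and \<theta> :: "real ^ 'd::enum ^ 'd::enum \<Rightarrow> nat \<Rightarrow> real ^ 'p::enum"
  assumes depth: "L \<ge> 1"
    and widths: "m 0 = CARD('d::enum)" "\<And>j. j \<in> {1..L+1} \<Longrightarrow> m j \<ge> 1" "m (L + 1) = 1"
    and params: "CARD('p::enum) = num_params L m"
    and f: "f = network L m \<sigma>"
    and D: "prob_space D" "sets D = sets borel"
    and finite_loss: "\<And>\<theta>. integrable D (\<lambda>(x, y). l y (f \<theta> x))"
    and \<rho>: "prob_space \<rho>" "sets \<rho> = sets borel" "rotationally_invariant \<rho>"
    and EGOP_wd: "EGOP_well_defined \<rho> (loss D l f)"
    and V: "eigenbasis_selection \<rho> m (\<lambda>U. rotated_loss D l U f) V"
    and run: "\<And>U. orthogonal_matrix U \<Longrightarrow>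
       iterates_of update (rotated_loss D l U (reparam (V U) f)) \<theta>0 T (\<theta> U)"
  shows "\<forall>U. orthogonal_matrix U \<longrightarrow>
      (\<forall>x. \<forall>t\<in>{1..T}.
         reparam (V U) f (\<theta> U t) x = reparam (V (mat 1)) f (\<theta> (mat 1) t) (transpose U *v x)) \<and>
      (\<forall>t\<in>{1..T}. \<theta> U t = \<theta> (mat 1) t)"
proof (intro allI impI)
  fix U :: "real ^ 'd::enum ^ 'd::enum"
  assume U: "orthogonal_matrix U"
  let ?I = "mat 1 :: real ^ 'd::enum ^ 'd::enum"
  have I: "orthogonal_matrix ?I" by (rule orthogonal_matrix_id)
  define Q :: "real ^ 'p::enum ^ 'p::enum" where "Q = input_rotation m U"
  have p: "m 1 * CARD('d) \<le> CARD('p)"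
    using first_block_le_num_params[of m L] widths(1) params by simp
  have Q: "orthogonal_matrix Q"
    unfolding Q_def by (rule orthogonal_matrix_input_rotation[of m U, OF p U])
  have net: "f (Q *v \<eta>) x = f \<eta> (U *v x)" for \<eta> x
    unfolding f Q_def by (rule network_input_rotation[OF widths(1) params depth widths(3)])
  \<comment> \<open>\<open>finite_loss\<close> supplies the integrability that the change of
    variables requires.\<close>
  have loss_I: "rotated_loss D l ?I f = loss D l f"
    by (rule ext) (simp add: rotated_loss_eq[OF D(2) finite_loss] loss_def)
  have loss_U: "rotated_loss D l U f = (\<lambda>\<eta>. loss D l f (Q *v \<eta>))"
    by (rule ext) (simp add: rotated_loss_eq[OF D(2) finite_loss] loss_def net)
  have "EGOP \<rho> (rotated_loss D l U f) = transpose Q ** EGOP \<rho> (rotated_loss D l ?I f) ** Q"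
    unfolding loss_U loss_I by (rule EGOP_compose_orthogonal[OF Q \<rho>(2,3) EGOP_wd])
  \<comment> \<open>The conjugation identity is the premise of the consistency convention, which
    singles out this eigenbasis among the possible ones.\<close>
  then have V_U: "V U = transpose Q ** V ?I"
    using V U unfolding eigenbasis_selection_def Q_def by blast
  have Q_V: "Q *v (V U *v \<eta>) = V ?I *v \<eta>" for \<eta>
  proof -
    have "Q ** V U = V ?I"
      using Q by (simp add: V_U matrix_mul_assoc orthogonal_matrix_def)
    then show ?thesis by (simp add: matrix_vector_mul_assoc)
  qed
  have reparam_loss: "rotated_loss D l W (reparam A f) = (\<lambda>\<eta>. rotated_loss D l W f (A *v \<eta>))" for W A
    by (simp add: rotated_loss_def loss_def reparam_def fun_eq_iff)
  \<comment> \<open>Both sides send \<open>\<eta>\<close> to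
    \<open>loss D l f (V ?I *v \<eta>)\<close>, so the algorithm is run twice on one and the same
    objective.\<close>
  have "rotated_loss D l U (reparam (V U) f) = rotated_loss D l ?I (reparam (V ?I) f)"
    unfolding reparam_loss loss_U loss_I Q_V ..
  then have same: "\<theta> U t = \<theta> ?I t" if "t \<le> T" for t
    using iterates_of_unique[of update _ \<theta>0 T] run[OF U] run[OF I] that by metis
  \<comment> \<open>The forward maps are related at every parameter, not only along the iterates:
    \<open>net\<close> is applied at the input \<open>transpose U *v x\<close>, and
    \<open>Q_V\<close> rewrites the parameter.\<close>
  have "reparam (V U) f \<eta> x = reparam (V ?I) f \<eta> (transpose U *v x)" for \<eta> x
  proof -
    have "U *v (transpose U *v x) = x"
      using U by (simp add: matrix_vector_mul_assoc orthogonal_matrix_def del: transpose_matrix_vector)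
    then show ?thesis using net[of "V U *v \<eta>" "transpose U *v x"] by (simp add: reparam_def Q_V)
  qed
  with same show "(\<forall>x. \<forall>t\<in>{1..T}.
      reparam (V U) f (\<theta> U t) x = reparam (V ?I) f (\<theta> ?I t) (transpose U *v x)) \<and>
      (\<forall>t\<in>{1..T}. \<theta> U t = \<theta> ?I t)"
    by simp
qed

end
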